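(* Let $k^t,k^d\in\mathbb{N}$ and $\alpha>0$. For every deterministic online policy $\mathrm{ALG}$ for the relief distribution problem there is an instance $I$ with $k^t$ trucks, $k^d$ drones and drone speed $\alpha$ such that $$\frac{\mathrm{ALG}(I)}{\mathrm{OPT}(I^* )}\ \ge\ \min\left\{\frac{2}{\alpha},\ 2\alpha\right\}.$$
   Context: Relief distribution problem (RDP). $\mathbb{N}=\{1,2,\dots\}$. An instance is $I=(k^t,k^d,\alpha,G,D)$: $k^t,k^d\in\mathbb{N}$ are the numbers of trucks and drones; $\alpha>0$ is the drone speed; $G=(V,E,c)$ is a finite connected undirected graph (not necessarily complete) with $V=\{v_0\}\cup C$, where $v_0$ is the depot and $C\neq\emptyset$ is the set of non-depot nodes; edge lengths $c(i,j)>0$ satisfy the triangle inequality; $D\subseteq C$ is the set of damaged nodes. For non-adjacent $i,j$, $c(i,j)$ is the shortest-path distance. A truck needs time $c(i,j)$ to traverse an edge, a drone needs $\frac1\alpha c(i,j)$. A tour is a closed walk in $G$ starting and ending at $v_0$ (possibly of length $0$); it visits all nodes lying on it. The makespan of a family of tours is the maximum duration of a tour. A feasible solution consists of $k^t$ truck tours and $k^d$ drone tours such that every node of $C$ is visited by some vehicle and every node of $D$ is visited by a truck. $\mathrm{OPT}(I^* )$ is the minimum makespan of a feasible solution ($I^*$ is the instance $I$ with $D$ known in advance). Online setting: initially everything except $D$ is known; whether $v\in C$ is damaged is revealed (to all vehicles, instantly) when some vehicle first arrives at $v$. A deterministic online policy $\mathrm{ALG}$ prescribes at every time, based only on the initially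 known data and the damage statuses revealed so far, how each vehicle acts (move along edges or wait), all vehicles starting at $v_0$ at time $0$, such that for every $D$ the executed tours form a feasible solution. $\mathrm{ALG}(I)$ is the time at which the last vehicle has returned to $v_0$. *)

theory Defs
  imports Complex_Main
begin

text \<open>
  The data of an instance that is known from the start, i.e. everything except the set of
  damaged nodes.  An edge is a two-element set of nodes, so that edge lengths are symmetric
  by construction; the values of \<open>edge_length\<close> outside \<open>edges\<close> are irrelevant.
\<close>

record rdp_data =
  trucks :: nat
  drones :: nat
  drone_speed :: real
  nodes :: "nat set"
  depot :: nat
  edges :: "nat set set"
  edge_length :: "nat set \<Rightarrow> real"

definition customers :: "rdp_data \<Rightarrow> nat set" where
  "customers K = nodes K - {depot K}"


section \<open>Walks and instances\<close>

definition walk :: "rdp_data \<Rightarrow> nat list \<Rightarrow> bool" where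
  "walk K p \<longleftrightarrow> p \<noteq> [] \<and> set p \<subseteq> nodes K \<and> successively (\<lambda>u w. {u, w} \<in> edges K) p"

definition walk_between :: "rdp_data \<Rightarrow> nat \<Rightarrow> nat \<Rightarrow> nat list \<Rightarrow> bool" where
  "walk_between K u w p \<longleftrightarrow> walk K p \<and> hd p = u \<and> last p = w"

definition walk_length :: "rdp_data \<Rightarrow> nat list \<Rightarrow> real" where
  "walk_length K p = (\<Sum>k<length p - 1. edge_length K {p ! k, p ! Suc k})"

definition cost :: "rdp_data \<Rightarrow> nat \<Rightarrow> nat \<Rightarrow> real" where
  "cost K u w = (if {u, w} \<in> edges K then edge_length K {u, w}
                 else Inf {walk_length K p | p. walk_between K u w p})"

definition rdp_instance :: "rdp_data \<Rightarrow> nat set \<Rightarrow> bool" where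
  "rdp_instance K D \<longleftrightarrow>
     trucks K \<ge> 1 \<and> drones K \<ge> 1 \<and> drone_speed K > 0 \<and>
     finite (nodes K) \<and> depot K \<in> nodes K \<and> customers K \<noteq> {} \<and>
     edges K \<subseteq> {{u, w} | u w. u \<in> nodes K \<and> w \<in> nodes K \<and> u \<noteq> w} \<and>
     (\<forall>u\<in>nodes K. \<forall>w\<in>nodes K. \<exists>p. walk_between K u w p) \<and>
     (\<forall>e\<in>edges K. edge_length K e > 0) \<and>
     (\<forall>u\<in>nodes K. \<forall>v\<in>nodes K. \<forall>w\<in>nodes K. cost K u w \<le> cost K u v + cost K v w) \<and>
     D \<subseteq> customers K"


section \<open>Feasible solutions and the offline optimum\<close>

datatype vehicle = Truck nat | Drone nat

definition vehicles :: "rdp_data \<Rightarrow> vehicle set" where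
  "vehicles K = Truck ` {..<trucks K} \<union> Drone ` {..<drones K}"

fun velocity :: "rdp_data \<Rightarrow> vehicle \<Rightarrow> real" where
  "velocity K (Truck i) = 1"
| "velocity K (Drone i) = drone_speed K"

definition tour :: "rdp_data \<Rightarrow> nat list \<Rightarrow> bool" where
  "tour K p \<longleftrightarrow> walk_between K (depot K) (depot K) p"

definition feasible :: "rdp_data \<Rightarrow> nat set \<Rightarrow> (vehicle \<Rightarrow> nat list) \<Rightarrow> bool" where
  "feasible K D T \<longleftrightarrow>
     (\<forall>x\<in>vehicles K. tour K (T x)) \<and>
     (\<forall>v\<in>customers K. \<exists>x\<in>vehicles K. v \<in> set (T x)) \<and>
     (\<forall>v\<in>D. \<exists>i<trucks K. v \<in> set (T (Truck i)))"

definition makespan :: "rdp_data \<Rightarrow> (vehicle \<Rightarrow> nat list) \<Rightarrow> real" where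
  "makespan K T = Max ((\<lambda>x. walk_length K (T x) / velocity K x) ` vehicles K)"

text \<open>
  The infimum is a minimum: positive edge lengths in a finite graph leave only finitely many
  tour families below any given makespan, up to tours of indices that are not vehicles.
\<close>

definition OPT :: "rdp_data \<Rightarrow> nat set \<Rightarrow> real" where
  "OPT K D = Inf {makespan K T | T. feasible K D T}"


section \<open>Online policies\<close>

text \<open>
  An itinerary consists of the sequence \<open>p\<close> of nodes of a walk and of departure times:
  the vehicle leaves \<open>p ! k\<close> in the direction of \<open>p ! Suc k\<close> at time \<open>d k\<close>.  It starts at time 0
  and stays at the last node forever; \<open>d k\<close> is irrelevant for \<open>Suc k \<ge> length p\<close>.
\<close>

type_synonym itinerary = "nat list \<times> (nat \<Rightarrow> real)"

fun arrival :: "rdp_data \<Rightarrow> vehicle \<Rightarrow> itinerary \<Rightarrow> nat \<Rightarrow> real" where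
  "arrival K x (p, d) 0 = 0"
| "arrival K x (p, d) (Suc k) = d k + edge_length K {p ! k, p ! Suc k} / velocity K x"

definition arrivals_at :: "rdp_data \<Rightarrow> (vehicle \<Rightarrow> itinerary) \<Rightarrow> nat \<Rightarrow> real set" where
  "arrivals_at K X v =
     {arrival K x (X x) k | x k. x \<in> vehicles K \<and> k < length (fst (X x)) \<and> fst (X x) ! k = v}"

text \<open>
  What has been revealed by time \<open>t\<close>: for every non-depot node reached by then, the time of the
  first arrival and whether the node is damaged.
\<close>

type_synonym info = "nat \<Rightarrow> (real \<times> bool) option"

definition revealed :: "rdp_data \<Rightarrow> nat set \<Rightarrow> (vehicle \<Rightarrow> itinerary) \<Rightarrow> real \<Rightarrow> info" where
  "revealed K D X t = (\<lambda>v.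
     if v \<in> customers K \<and> (\<exists>a\<in>arrivals_at K X v. a \<le> t)
     then Some (Min (arrivals_at K X v), v \<in> D) else None)"

text \<open>
  A policy may depend on the initially known data, the current time and the revealed
  information.  The current positions of the vehicles need not be passed, since they are
  determined by these arguments and the policy itself.
\<close>

datatype action = Wait | Move nat

type_synonym policy = "rdp_data \<Rightarrow> real \<Rightarrow> info \<Rightarrow> vehicle \<Rightarrow> action"

text \<open>
  \<open>X\<close> is the run of \<open>ALG\<close> when the set of damaged nodes is \<open>D\<close>.  A vehicle at a node obeys the
  prescribed action, and a vehicle that has entered an edge traverses it completely; the action
  prescribed during a traversal has no effect.
\<close>

definition executes ::
    "policy \<Rightarrow> rdp_data \<Rightarrow> nat set \<Rightarrow> (vehicle \<Rightarrow> itinerary) \<Rightarrow> bool" where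
  "executes ALG K D X \<longleftrightarrow> (\<forall>x\<in>vehicles K. \<exists>p d. X x = (p, d) \<and>
     walk K p \<and> hd p = depot K \<and>
     (\<forall>k. Suc k < length p \<longrightarrow>
        arrival K x (X x) k \<le> d k \<and>
        (\<forall>t. arrival K x (X x) k \<le> t \<and> t < d k \<longrightarrow> ALG K t (revealed K D X t) x = Wait) \<and>
        ALG K (d k) (revealed K D X (d k)) x = Move (p ! Suc k)) \<and>
     (\<forall>t\<ge>arrival K x (X x) (length p - 1). ALG K t (revealed K D X t) x = Wait))"

text \<open>
  Up to irrelevant values (see above) there is at most one run, because information and
  positions at a time determine how the run continues.
\<close>

definition execution :: "policy \<Rightarrow> rdp_data \<Rightarrow> nat set \<Rightarrow> vehicle \<Rightarrow> itinerary" where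
  "execution ALG K D = (SOME X. executes ALG K D X)"

definition online_policy :: "policy \<Rightarrow> bool" where
  "online_policy ALG \<longleftrightarrow> (\<forall>K D. rdp_instance K D \<longrightarrow>
     (\<exists>X. executes ALG K D X) \<and> feasible K D (\<lambda>x. fst (execution ALG K D x)))"

definition completion_time :: "rdp_data \<Rightarrow> (vehicle \<Rightarrow> itinerary) \<Rightarrow> real" where
  "completion_time K X =
     Max ((\<lambda>x. arrival K x (X x) (length (fst (X x)) - 1)) ` vehicles K)"

definition alg_makespan :: "policy \<Rightarrow> rdp_data \<Rightarrow> nat set \<Rightarrow> real" where
  "alg_makespan ALG K D = completion_time K (execution ALG K D)"

end

theory Submission
  imports Defs
begin

text \<open>
  The adversary uses a star with unit edges and one leaf per vehicle, so that offline every
  vehicle visits a single leaf.  Until some leaf is first reached, the policy has no information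
  and hence acts independently of the damaged set.  If the first vehicle to reach a leaf is a
  truck, that leaf is declared undamaged and \<open>kt\<close> others damaged; if it is a drone, that leaf is
  declared damaged.  Either way the visit is wasted, so by the pigeonhole principle some vehicle
  has to visit two leaves.
\<close>

section \<open>The star graph\<close>

definition star :: "nat \<Rightarrow> nat \<Rightarrow> real \<Rightarrow> rdp_data" where
  "star m n a = \<lparr>trucks = m, drones = n, drone_speed = a, nodes = {0..m + n}, depot = 0,
     edges = (\<lambda>v. {0, v}) ` {1..m + n}, edge_length = (\<lambda>_. 1)\<rparr>"

lemma star_simps [simp]:
  "trucks (star m n a) = m" "drones (star m n a) = n" "drone_speed (star m n a) = a"
  "nodes (star m n a) = {0..m + n}" "depot (star m n a) = 0" "edge_length (star m n a) e = 1"
  by (simp_all add: star_def)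

lemma edges_star [simp]:
  "{u, w} \<in> edges (star m n a) \<longleftrightarrow> u = 0 \<and> w \<in> {1..m + n} \<or> w = 0 \<and> u \<in> {1..m + n}"
  by (auto simp: star_def doubleton_eq_iff)

lemma customers_star [simp]: "customers (star m n a) = {1..m + n}"
  by (auto simp: customers_def)

lemma walk_length_star [simp]: "walk_length (star m n a) p = real (length p - 1)"
  by (simp add: walk_length_def)

lemma finite_vehicles [simp]: "finite (vehicles K)"
  by (simp add: vehicles_def)

lemma card_vehicles: "card (vehicles K) = trucks K + drones K"
proof -
  have "card (vehicles K) = card (Truck ` {..<trucks K}) + card (Drone ` {..<drones K})"
    unfolding vehicles_def by (rule card_Un_disjoint) auto
  then show ?thesis
    by (simp add: card_image inj_on_def)
qed

lemma velocity_star_pos: "a > 0 \<Longrightarrow> velocity (star m n a) x > 0"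
  by (cases x) auto


section \<open>The star is an instance\<close>

lemma cost_star_edge: "v \<in> {1..m + n} \<Longrightarrow> cost (star m n a) 0 v = 1 \<and> cost (star m n a) v 0 = 1"
  by (simp add: cost_def)

text \<open>Since \<open>{u, u}\<close> is not an edge, the infimum branch of \<open>cost\<close>
  applies, and the one-node walk attains it.\<close>

lemma cost_star_refl:
  assumes "u \<le> m + n"
  shows "cost (star m n a) u u = 0"
proof -
  have "Inf {walk_length (star m n a) p |p. walk_between (star m n a) u u p} = 0"
  proof (rule cInf_eq_minimum)
    show "0 \<in> {walk_length (star m n a) p |p. walk_between (star m n a) u u p}"
      using assms by (auto intro!: exI[of _ "[u]"] simp: walk_between_def walk_def)
  qed auto
  moreover have "{u, u} \<notin> edges (star m n a)"
    by (subst edges_star) auto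
  ultimately show ?thesis
    by (simp add: cost_def)
qed

text \<open>Leaves are adjacent only to the centre, so a walk between two distinct leaves has at
  least three nodes, and the one through the centre has exactly three.\<close>

lemma cost_star_leaves:
  assumes "u \<in> {1..m + n}" "w \<in> {1..m + n}" "u \<noteq> w"
  shows "cost (star m n a) u w = 2"
proof -
  have "Inf {walk_length (star m n a) p |p. walk_between (star m n a) u w p} = 2"
  proof (rule cInf_eq_minimum)
    show "2 \<in> {walk_length (star m n a) p |p. walk_between (star m n a) u w p}"
      using assms by (auto intro!: exI[of _ "[u, 0, w]"] simp: walk_between_def walk_def)
  next
    fix l assume "l \<in> {walk_length (star m n a) p |p. walk_between (star m n a) u w p}"
    then obtain p where l: "l = real (length p - 1)" and p: "walk_between (star m n a) u w p"
      by auto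
    have "length p \<ge> 3"
    proof (rule ccontr)
      assume "\<not> length p \<ge> 3"
      then have "length p = 0 \<or> length p = 1 \<or> length p = 2" by linarith
      then show False
        using p assms
        by (auto simp: walk_between_def walk_def length_Suc_conv numeral_2_eq_2)
    qed
    then show "2 \<le> l" using l by linarith
  qed
  then show ?thesis
    using assms by (simp add: cost_def)
qed

lemma cost_star:
  assumes "u \<le> m + n" "w \<le> m + n"
  shows "cost (star m n a) u w = (if u = w then 0 else if u = 0 \<or> w = 0 then 1 else 2)"
  using assms cost_star_refl[of u m n a] cost_star_edge[of u m n a] cost_star_edge[of w m n a]
    cost_star_leaves[of u m n w a]
  by auto

lemma walk_between_star_exists:
  assumes "u \<le> m + n" "w \<le> m + n"
  shows "\<exists>p. walk_between (star m n a) u w p"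
proof -
  consider "u = w" | "u \<noteq> w" "u = 0 \<or> w = 0" | "u \<noteq> 0" "w \<noteq> 0" by auto
  then show ?thesis
  proof cases
    case 1
    then show ?thesis
      using assms by (intro exI[of _ "[u]"]) (simp add: walk_between_def walk_def)
  next
    case 2
    then show ?thesis
      using assms by (intro exI[of _ "[u, w]"]) (auto simp: walk_between_def walk_def)
  next
    case 3
    then show ?thesis
      using assms by (intro exI[of _ "[u, 0, w]"]) (auto simp: walk_between_def walk_def)
  qed
qed

lemma rdp_instance_star:
  assumes "m \<ge> 1" "n \<ge> 1" "a > 0" "D \<subseteq> {1..m + n}"
  shows "rdp_instance (star m n a) D"
proof -
  have "edges (star m n a) \<subseteq> {{u, w} |u w. u \<in> {0..m + n} \<and> w \<in> {0..m + n} \<and> u \<noteq> w}"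
    by (fastforce simp: star_def)
  then show ?thesis
    using assms walk_between_star_exists[of _ m n _ a]
    by (auto simp: rdp_instance_def cost_star)
qed


section \<open>Tours in the star and the offline optimum\<close>

lemma tour_star_leaf_length:
  assumes "tour (star m n a) p" "v \<in> set p" "v \<noteq> 0"
  shows "length p \<ge> 3"
proof (rule ccontr)
  assume "\<not> length p \<ge> 3"
  then have "length p = 0 \<or> length p = 1 \<or> length p = 2" by linarith
  then show False
    using assms
    by (auto simp: tour_def walk_between_def walk_def length_Suc_conv numeral_2_eq_2)
qed

text \<open>The star is bipartite, so a closed walk has an odd number of nodes. Below five nodes, a
  tour that reaches a leaf therefore has exactly three. Visiting a second leaf thus requires four
  edges instead of two.\<close>

lemma short_tour_star_leaf:
  assumes "tour (star m n a) p" "v \<in> set p" "v \<noteq> 0" "length p < 5"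
  shows "p = [0, v, 0]"
proof -
  have "length p = 3 \<or> length p = 4"
    using tour_star_leaf_length[OF assms(1-3)] assms(4) by linarith
  then show ?thesis
    using assms
    by (auto simp: tour_def walk_between_def walk_def length_Suc_conv numeral_eq_Suc)
qed

text \<open>Some vehicle has to visit leaf \<open>1\<close>, going out and back along a unit edge.
  This crude bound makes the optimum positive and bounds the set of makespans from below.\<close>

lemma makespan_star_lower:
  assumes "m \<ge> 1" "a > 0" "feasible (star m n a) D T"
  shows "min 2 (2 / a) \<le> makespan (star m n a) T"
proof -
  obtain x where x: "x \<in> vehicles (star m n a)" "1 \<in> set (T x)"
    using assms by (fastforce simp: feasible_def)
  then have "length (T x) \<ge> 3"
    using assms by (intro tour_star_leaf_length[of m n a _ 1]) (auto simp: feasible_def)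
  then have "2 / velocity (star m n a) x \<le> walk_length (star m n a) (T x) / velocity (star m n a) x"
    using velocity_star_pos[OF assms(2), of m n x] by (intro divide_right_mono) auto
  also have "\<dots> \<le> makespan (star m n a) T"
    unfolding makespan_def using x by (intro Max_ge) auto
  finally show ?thesis
    by (cases x) auto
qed

text \<open>With exactly \<open>m\<close> damaged leaves, each truck can serve one damaged leaf and
  each drone one undamaged leaf, so every vehicle traverses just two edges. Positivity is needed to
  divide by the optimum later.\<close>

lemma OPT_star:
  assumes "m \<ge> 1" "n \<ge> 1" "a > 0" "D \<subseteq> {1..m + n}" "card D = m"
  shows "0 < OPT (star m n a) D" "OPT (star m n a) D \<le> max 2 (2 / a)"
proof -
  let ?K = "star m n a"
  let ?M = "{makespan ?K T |T. feasible ?K D T}"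
  have fin: "finite D" using assms(4) finite_subset by blast
  have "card ({1..m + n} - D) = n"
    using assms fin by (simp add: card_Diff_subset)
  then obtain g where g: "bij_betw g {..<n} ({1..m + n} - D)"
    by (metis bij_betw_iff_card card_lessThan finite_Diff finite_atLeastAtMost finite_lessThan)
  obtain h where h: "bij_betw h {..<m} D"
    using fin assms(5) by (metis bij_betw_iff_card card_lessThan finite_lessThan)
  \<comment> \<open>Bijections \<open>h\<close> and \<open>g\<close> assign the damaged leaves to
    the trucks and the other leaves to the drones.\<close>
  define T where "T = (\<lambda>x. case x of Truck i \<Rightarrow> [0, h i, 0] | Drone j \<Rightarrow> [0, g j, 0])"
  have hD: "h ` {..<m} = D" and gD: "g ` {..<n} = {1..m + n} - D"
    using g h by (simp_all add: bij_betw_def)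
  have leaf: "tour ?K [0, v, 0]" if "v \<in> {1..m + n}" for v
    using that by (auto simp: tour_def walk_between_def walk_def)
  have tours: "tour ?K (T x)" if "x \<in> vehicles ?K" for x
    using that hD gD assms(4) by (auto simp: vehicles_def T_def intro!: leaf[simplified])
  have D: "\<exists>i<m. v \<in> set (T (Truck i))" if "v \<in> D" for v
    using that hD by (auto simp: T_def)
  have C: "\<exists>x\<in>vehicles ?K. v \<in> set (T x)" if v: "v \<in> {1..m + n}" for v
  proof (cases "v \<in> D")
    case True
    then show ?thesis using D by (force simp: vehicles_def)
  next
    case False
    then obtain j where "j < n" "v = g j" using gD v by blast
    then show ?thesis by (auto simp: vehicles_def T_def intro!: bexI[of _ "Drone j"])
  qed
  have feas: "feasible ?K D T"
    using tours C D by (auto simp: feasible_def)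
  have lower: "min 2 (2 / a) \<le> s" if "s \<in> ?M" for s
    using that makespan_star_lower[OF assms(1,3)] by auto
  have "min 2 (2 / a) \<le> OPT ?K D"
    unfolding OPT_def using feas lower by (intro cInf_greatest) auto
  then show "0 < OPT ?K D"
    using assms(3) by (smt (verit) divide_pos_pos)
  have "OPT ?K D \<le> makespan ?K T"
    unfolding OPT_def using feas lower by (intro cInf_lower bdd_belowI[of _ "min 2 (2 / a)"]) auto
  also have "\<dots> \<le> max 2 (2 / a)"
    unfolding makespan_def
  proof (rule Max.boundedI)
    show "(\<lambda>x. walk_length ?K (T x) / velocity ?K x) ` vehicles ?K \<noteq> {}"
      using assms(1) by (auto simp: vehicles_def lessThan_empty_iff)
  qed (auto simp: vehicles_def T_def)
  finally show "OPT ?K D \<le> max 2 (2 / a)" .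
qed


section \<open>Runs before the first revelation\<close>

lemma executesD:
  assumes "executes ALG K D X" "x \<in> vehicles K" "X x = (p, d)"
  shows "walk K p" "hd p = depot K"
    "\<And>k. Suc k < length p \<Longrightarrow> arrival K x (p, d) k \<le> d k"
    "\<And>k t. \<lbrakk>Suc k < length p; arrival K x (p, d) k \<le> t; t < d k\<rbrakk>
       \<Longrightarrow> ALG K t (revealed K D X t) x = Wait"
    "\<And>k. Suc k < length p \<Longrightarrow> ALG K (d k) (revealed K D X (d k)) x = Move (p ! Suc k)"
    "\<And>t. arrival K x (p, d) (length p - 1) \<le> t \<Longrightarrow> ALG K t (revealed K D X t) x = Wait"
  using assms unfolding executes_def by fastforce+

text \<open>With equal information up to time \<open>d 0\<close>, the policy issues the same
  commands to \<open>x\<close> in both runs while \<open>x\<close> is still at the depot. Leaving at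
  different times would require both \<open>Wait\<close> and \<open>Move\<close> at the earlier
  departure.\<close>

lemma executes_first_move_agrees:
  assumes X: "executes ALG K D X" "X x = (p, d)" "Suc 0 < length p"
    and X': "executes ALG K D' X'" "X' x = (p', d')"
    and x: "x \<in> vehicles K"
    and eq: "\<And>t. t \<le> d 0 \<Longrightarrow> revealed K D X t = revealed K D' X' t"
  shows "Suc 0 < length p'" "p' ! Suc 0 = p ! Suc 0" "d' 0 = d 0"
proof -
  note E = executesD[OF X(1) x X(2)] and E' = executesD[OF X'(1) x X'(2)]
  have d0: "0 \<le> d 0" and move: "ALG K (d 0) (revealed K D' X' (d 0)) x = Move (p ! Suc 0)"
    using E(3)[of 0] E(5)[of 0] X(3) eq by auto
  show len: "Suc 0 < length p'"
  proof (rule ccontr)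
    assume "\<not> Suc 0 < length p'"
    \<comment> \<open>A vehicle that never leaves is at its last node from time 0 on, so it would
      have to be told \<open>Wait\<close> at time \<open>d 0\<close>.\<close>
    then have "length p' - 1 = 0" by simp
    then show False using E'(6)[of "d 0"] d0 move by simp
  qed
  have "\<not> d 0 < d' 0"
    using E'(4)[of 0 "d 0"] len d0 move by auto
  moreover have "\<not> d' 0 < d 0"
  proof
    assume less: "d' 0 < d 0"
    have "ALG K (d' 0) (revealed K D X (d' 0)) x = Wait"
      using E(4)[of 0 "d' 0"] E'(3)[of 0] len X(3) less by simp
    then show False
      using E'(5)[of 0] len eq[of "d' 0"] less by simp
  qed
  ultimately show "d' 0 = d 0" by simp
  then show "p' ! Suc 0 = p ! Suc 0"
    using E'(5)[of 0] len move by simp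
qed

text \<open>Each of the \<open>k\<close> unit edges takes \<open>1 / velocity\<close>, and waiting
  only adds to this.\<close>

lemma arrival_star_lower:
  assumes "a > 0" "executes ALG (star m n a) D X" "x \<in> vehicles (star m n a)" "X x = (p, d)"
    and "k < length p"
  shows "real k / velocity (star m n a) x \<le> arrival (star m n a) x (p, d) k"
  using assms(5)
proof (induction k)
  case (Suc k)
  then show ?case
    using executesD(3)[OF assms(2-4), of k] by (simp add: add_divide_distrib)
qed simp

lemma arrival_star_first:
  assumes "a > 0" "executes ALG (star m n a) D X" "x \<in> vehicles (star m n a)" "X x = (p, d)"
    and "Suc k < length p"
  shows "d 0 + 1 / velocity (star m n a) x \<le> arrival (star m n a) x (p, d) (Suc k)"
  using assms(5)
proof (induction k)
  case (Suc k)
  then have "arrival (star m n a) x (p, d) (Suc k) \<le> d (Suc k)"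
    using executesD(3)[OF assms(2-4), of "Suc k"] by simp
  moreover have "0 \<le> 1 / velocity (star m n a) x"
    using velocity_star_pos[OF assms(1), of m n x] by simp
  moreover have "d 0 + 1 / velocity (star m n a) x \<le> arrival (star m n a) x (p, d) (Suc k)"
    using Suc by simp
  ultimately show ?case
    by (simp only: arrival.simps star_simps)
qed simp

text \<open>The summand \<open>1\<close> is the unit edge length of the star. The value is
  meaningful only for vehicles that leave the depot, since otherwise departure time \<open>0\<close>
  of the itinerary is arbitrary.\<close>

definition first_arrival :: "rdp_data \<Rightarrow> (vehicle \<Rightarrow> itinerary) \<Rightarrow> vehicle \<Rightarrow> real" where
  "first_arrival K X x = snd (X x) 0 + 1 / velocity K x"

definition movers :: "rdp_data \<Rightarrow> (vehicle \<Rightarrow> itinerary) \<Rightarrow> vehicle set" where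
  "movers K X = {x \<in> vehicles K. Suc 0 < length (fst (X x))}"

text \<open>Walks start at the depot, so no vehicle is at a leaf before its first move ends. The
  inequality is strict because an arrival at time \<open>t\<close> itself already counts as
  revealed.\<close>

lemma revealed_star_empty:
  assumes "a > 0" "executes ALG (star m n a) D X"
    and "\<And>x. x \<in> movers (star m n a) X \<Longrightarrow> t < first_arrival (star m n a) X x"
  shows "revealed (star m n a) D X t = (\<lambda>_. None)"
proof -
  have "\<not> b \<le> t" if v: "v \<in> {1..m + n}" and b: "b \<in> arrivals_at (star m n a) X v" for v b
  proof -
    obtain x k where x: "x \<in> vehicles (star m n a)" and k: "k < length (fst (X x))"
      "fst (X x) ! k = v" and bk: "b = arrival (star m n a) x (X x) k"
      using b by (auto simp: arrivals_at_def)
    obtain p d where Xx: "X x = (p, d)" by fastforce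
    have "p ! 0 = 0"
      using executesD(1,2)[OF assms(2) x Xx] by (simp add: walk_def hd_conv_nth)
    \<comment> \<open>Position 0 is the depot, whereas \<open>v\<close> is a leaf.\<close>
    then obtain j where j: "k = Suc j"
      using k v Xx by (cases k) auto
    have "t < first_arrival (star m n a) X x"
      using x k j by (intro assms(3)) (auto simp: movers_def)
    also have "\<dots> \<le> b"
      using arrival_star_first[OF assms(1,2) x Xx, of j] k j bk Xx by (simp add: first_arrival_def)
    finally show ?thesis by simp
  qed
  then show ?thesis
    by (fastforce simp: revealed_def)
qed

text \<open>An edge takes positive time, so \<open>x\<close> departs strictly before the earliest
  arrival in either run. Up to that departure both runs have revealed nothing, and hence treat
  \<open>x\<close> alike.\<close>

lemma first_move_star_transfer:
  assumes "a > 0" "executes ALG (star m n a) D X" "executes ALG (star m n a) D' X'"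
    and x: "x \<in> movers (star m n a) X"
    and "\<And>y. y \<in> movers (star m n a) X \<Longrightarrow>
           first_arrival (star m n a) X x \<le> first_arrival (star m n a) X y"
    and "\<And>y. y \<in> movers (star m n a) X' \<Longrightarrow>
           first_arrival (star m n a) X x \<le> first_arrival (star m n a) X' y"
  shows "x \<in> movers (star m n a) X'" "fst (X' x) ! Suc 0 = fst (X x) ! Suc 0"
    "first_arrival (star m n a) X' x = first_arrival (star m n a) X x"
proof -
  obtain p d p' d' where Xx: "X x = (p, d)" "X' x = (p', d')" by fastforce
  have veh: "x \<in> vehicles (star m n a)" and len: "Suc 0 < length p"
    using x Xx by (auto simp: movers_def)
  have "d 0 < first_arrival (star m n a) X x"
    using velocity_star_pos[OF assms(1), of m n x] Xx by (simp add: first_arrival_def)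
  then have eq: "revealed (star m n a) D X t = revealed (star m n a) D' X' t" if "t \<le> d 0" for t
    using revealed_star_empty[OF assms(1,2), of t] revealed_star_empty[OF assms(1,3), of t]
      assms(5,6) that by force
  note agree = executes_first_move_agrees[OF assms(2) Xx(1) len assms(3) Xx(2) veh eq]
  show "x \<in> movers (star m n a) X'" "fst (X' x) ! Suc 0 = fst (X x) ! Suc 0"
    "first_arrival (star m n a) X' x = first_arrival (star m n a) X x"
    using agree veh Xx by (simp_all add: movers_def first_arrival_def)
qed

text \<open>The remaining task is to show that no arrival in the second run precedes that of
  \<open>x\<close>. This follows by exchanging the roles of the two runs.\<close>

lemma first_mover_star_independent:
  assumes "a > 0" "executes ALG (star m n a) D X" "executes ALG (star m n a) D' X'"
    and "x \<in> movers (star m n a) X"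
    and "\<And>y. y \<in> movers (star m n a) X \<Longrightarrow>
           first_arrival (star m n a) X x \<le> first_arrival (star m n a) X y"
  shows "x \<in> movers (star m n a) X' \<and> fst (X' x) ! Suc 0 = fst (X x) ! Suc 0"
proof -
  have fin: "finite (movers (star m n a) X')" by (simp add: movers_def)
  have "first_arrival (star m n a) X x \<le> first_arrival (star m n a) X' y"
    if "y \<in> movers (star m n a) X'" for y
  proof -
    define z where "z = arg_min_on (first_arrival (star m n a) X') (movers (star m n a) X')"
    have z: "z \<in> movers (star m n a) X'"
      and z_min: "\<And>w. w \<in> movers (star m n a) X' \<Longrightarrow>
             first_arrival (star m n a) X' z \<le> first_arrival (star m n a) X' w"
      unfolding z_def using arg_min_if_finite(1)[OF fin] arg_min_least[OF fin] that by blast+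
    have "first_arrival (star m n a) X x \<le> first_arrival (star m n a) X' z"
    \<comment> \<open>If the earliest mover \<open>z\<close> of \<open>X'\<close> were earlier than
      \<open>x\<close>, it would precede all movers of \<open>X\<close>. Its first move would then
      transfer to \<open>X\<close> with the same arrival time, against the minimality of
      \<open>x\<close>.\<close>
    proof (rule ccontr)
      assume "\<not> first_arrival (star m n a) X x \<le> first_arrival (star m n a) X' z"
      then have "first_arrival (star m n a) X' z < first_arrival (star m n a) X w"
        if "w \<in> movers (star m n a) X" for w
        using assms(5)[OF that] by simp
      then show False
        using first_move_star_transfer(1,3)[OF assms(1,3,2) z z_min] by (metis less_irrefl less_imp_le)
    qed
    then show ?thesis using z_min[OF that] by simp
  qed
  then show ?thesis
    using first_move_star_transfer(1,2)[OF assms] by blast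
qed


section \<open>The adversary\<close>

lemma execution_executes:
  assumes "online_policy ALG" "rdp_instance K D"
  shows "executes ALG K D (execution ALG K D)" "feasible K D (\<lambda>x. fst (execution ALG K D x))"
proof -
  show "executes ALG K D (execution ALG K D)"
    unfolding execution_def using assms
    by (intro someI_ex[of "executes ALG K D"]) (simp add: online_policy_def)
  show "feasible K D (\<lambda>x. fst (execution ALG K D x))"
    using assms by (simp add: online_policy_def)
qed

text \<open>Five nodes mean four unit edges, each taking time \<open>1\<close> for a truck and
  \<open>1 / a\<close> for a drone.\<close>

lemma completion_time_star_lower:
  assumes "a > 0" "executes ALG (star m n a) D X" "x \<in> vehicles (star m n a)"
    and "length (fst (X x)) \<ge> 5"
  shows "min 4 (4 / a) \<le> completion_time (star m n a) X"
proof -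
  obtain p d where Xx: "X x = (p, d)" by fastforce
  have "4 / velocity (star m n a) x \<le> real (length p - 1) / velocity (star m n a) x"
    using velocity_star_pos[OF assms(1), of m n x] assms(4) Xx by (intro divide_right_mono) auto
  also have "\<dots> \<le> arrival (star m n a) x (X x) (length (fst (X x)) - 1)"
    using arrival_star_lower[OF assms(1-3) Xx, of "length p - 1"] assms(4) Xx by simp
  also have "\<dots> \<le> completion_time (star m n a) X"
    unfolding completion_time_def using assms(3) by (intro Max_ge) auto
  finally show ?thesis by (cases x) auto
qed

text \<open>If all tours had fewer than five nodes, each vehicle would visit at most one leaf. The
  wasted visit of \<open>x\<close> then leaves one vehicle too few, among the trucks for the damaged
  leaves or among all vehicles for all leaves.\<close>

lemma feasible_star_long_tour:
  assumes feas: "feasible (star m n a) D T" and x: "x \<in> vehicles (star m n a)"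
    and v: "v \<in> {1..m + n}" "v \<in> set (T x)"
    and D: "D \<subseteq> {1..m + n}" "card D = m"
    and wasted: "case x of Truck i \<Rightarrow> v \<notin> D | Drone j \<Rightarrow> v \<in> D"
  shows "\<exists>y\<in>vehicles (star m n a). length (T y) \<ge> 5"
proof (rule ccontr)
  assume "\<not> ?thesis"
  then have short: "T y = [0, w, 0]" if "y \<in> vehicles (star m n a)" "w \<in> {1..m + n}" "w \<in> set (T y)" for y w
    using that feas by (intro short_tour_star_leaf[of m n a]) (auto simp: feasible_def not_le)
  \<comment> \<open>The only leaf on the short tour of \<open>y\<close>, if it visits one; otherwise
    the value is irrelevant.\<close>
  define f where "f y = T y ! 1" for y
  have f: "f y = w" if "y \<in> vehicles (star m n a)" "w \<in> {1..m + n}" "w \<in> set (T y)" for y w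
    using short[OF that] by (simp add: f_def)
  have fx: "f x = v" using f x v by blast
  have truck: "\<exists>i<m. f (Truck i) = w" if w: "w \<in> D" for w
  proof -
    obtain i where "i < m" "w \<in> set (T (Truck i))"
      using feas w by (auto simp: feasible_def)
    then have "i < m" "f (Truck i) = w"
      using f[of "Truck i" w] subsetD[OF D(1) w] by (simp_all add: vehicles_def)
    then show ?thesis by blast
  qed
  show False
  proof (cases x)
    case (Truck i)
    then have i: "i < m" "v \<notin> D" using x wasted by (auto simp: vehicles_def)
    \<comment> \<open>Truck \<open>i\<close> spends its only leaf on the undamaged \<open>v\<close>,
      so the other \<open>m - 1\<close> trucks would have to cover all \<open>m\<close> damaged
      leaves.\<close>
    have "D \<subseteq> (\<lambda>i. f (Truck i)) ` ({..<m} - {i})"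
    proof
      fix w assume w: "w \<in> D"
      obtain j where "j < m" "f (Truck j) = w" using truck[OF w] by blast
      moreover from this have "j \<noteq> i" using fx Truck i w by auto
      ultimately show "w \<in> (\<lambda>i. f (Truck i)) ` ({..<m} - {i})" by blast
    qed
    then have "card D \<le> card ({..<m} - {i})"
      by (meson surj_card_le finite_Diff finite_lessThan)
    then show False using D(2) i by simp
  next
    case (Drone j)
    then have "v \<in> D" using wasted by simp
    then obtain i where i: "i < m" "f (Truck i) = v" using truck by blast
    \<comment> \<open>The damaged leaf \<open>v\<close> also needs a truck, so the drone
      \<open>x\<close> contributes no leaf of its own and the other \<open>m + n - 1\<close>
      vehicles would have to cover all \<open>m + n\<close> leaves.\<close>
    have "{1..m + n} \<subseteq> f ` (vehicles (star m n a) - {x})"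
    proof
      fix w assume w: "w \<in> {1..m + n}"
      then obtain y where y: "y \<in> vehicles (star m n a)" "w \<in> set (T y)"
        using feas by (fastforce simp: feasible_def)
      then have fy: "f y = w" using f w by blast
      show "w \<in> f ` (vehicles (star m n a) - {x})"
      proof (cases "y = x")
        case True
        then show ?thesis
          using i fx fy Drone by (intro image_eqI[of _ _ "Truck i"]) (auto simp: vehicles_def)
      next
        case False
        then show ?thesis using y fy by blast
      qed
    qed
    then have "card {1..m + n} \<le> card (vehicles (star m n a) - {x})"
      by (meson surj_card_le finite_Diff finite_vehicles)
    \<comment> \<open>Ensures that removing \<open>x\<close> strictly lowers the count despite
      truncated subtraction.\<close>
    moreover have "card (vehicles (star m n a)) \<ge> 1"
      using x by (simp add: card_gt_0_iff Suc_le_eq) blast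
    ultimately show False using x by (simp add: card_vehicles)
  qed
qed

lemma subset_with_card_containing:
  assumes "finite A" "v \<in> A" "1 \<le> k" "k \<le> card A"
  obtains B where "B \<subseteq> A" "card B = k" "v \<in> B"
proof -
  have "k - 1 \<le> card (A - {v})" using assms by simp
  then obtain C where C: "C \<subseteq> A - {v}" "card C = k - 1" "finite C"
    by (rule obtain_subset_with_card_n)
  show ?thesis
  proof (rule that)
    show "insert v C \<subseteq> A" using C assms by blast
    show "card (insert v C) = k"
      using C assms(3) by (subst card_insert_disjoint) auto
  qed simp
qed

text \<open>At least one drone means that \<open>m\<close> leaves remain besides \<open>v\<close>;
  at least one truck means that \<open>D\<close> has room for \<open>v\<close>.\<close>

lemma wasting_damage_set:
  assumes "m \<ge> 1" "n \<ge> 1" "v \<in> {1..m + n}"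
  obtains D where "D \<subseteq> {1..m + n}" "card D = m"
    "case x of Truck i \<Rightarrow> v \<notin> D | Drone j \<Rightarrow> v \<in> D"
proof (cases x)
  case (Truck i)
  have "m \<le> card ({1..m + n} - {v})" using assms by simp
  then obtain D where "D \<subseteq> {1..m + n} - {v}" "card D = m"
    by (rule obtain_subset_with_card_n)
  then show ?thesis using that Truck by auto
next
  case (Drone j)
  obtain D where "D \<subseteq> {1..m + n}" "card D = m" "v \<in> D"
    using subset_with_card_containing[of "{1..m + n}" v m] assms by auto
  then show ?thesis using that Drone by auto
qed

text \<open>The damage set has to depend on the first visit, which occurs in a run that itself
  depends on the damage set. The circle is broken by reading off the first visit in a reference run
  without damage and carrying it over to the run with the chosen \<open>D\<close>.\<close>

lemma alg_makespan_star_lower: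
  assumes "m \<ge> 1" "n \<ge> 1" "a > 0" "online_policy ALG"
  obtains D where "D \<subseteq> {1..m + n}" "card D = m"
    "min 4 (4 / a) \<le> alg_makespan ALG (star m n a) D"
proof -
  let ?K = "star m n a"
  define X0 where "X0 = execution ALG ?K {}"
  have X0: "executes ALG ?K {} X0" "feasible ?K {} (\<lambda>x. fst (X0 x))"
    unfolding X0_def using execution_executes assms rdp_instance_star by blast+
  obtain y where y: "y \<in> vehicles ?K" "1 \<in> set (fst (X0 y))"
    using X0(2) assms(1) by (fastforce simp: feasible_def)
  have "length (fst (X0 y)) \<ge> 3"
    using X0(2) y by (intro tour_star_leaf_length[of m n a _ 1]) (auto simp: feasible_def)
  with y have ne: "movers ?K X0 \<noteq> {}" by (auto simp: movers_def)
  have fin: "finite (movers ?K X0)" by (simp add: movers_def)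
  \<comment> \<open>A vehicle that is among the first to reach a leaf in the reference run; ties are
    broken arbitrarily.\<close>
  define x where "x = arg_min_on (first_arrival ?K X0) (movers ?K X0)"
  have x: "x \<in> movers ?K X0"
    and x_min: "\<And>y. y \<in> movers ?K X0 \<Longrightarrow> first_arrival ?K X0 x \<le> first_arrival ?K X0 y"
    unfolding x_def using arg_min_if_finite(1)[OF fin ne] arg_min_least[OF fin ne] by blast+
  define v where "v = fst (X0 x) ! Suc 0"
  have xv: "x \<in> vehicles ?K" and len: "Suc 0 < length (fst (X0 x))"
    using x by (auto simp: movers_def)
  obtain p d where Xx: "X0 x = (p, d)" by fastforce
  obtain w ws where p: "p = 0 # w # ws"
    using executesD(2)[OF X0(1) xv Xx] len Xx by (cases p rule: list.exhaust; cases "tl p") auto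
  have v: "v \<in> {1..m + n}"
    using executesD(1)[OF X0(1) xv Xx] p Xx by (auto simp: v_def walk_def)
  obtain D where D: "D \<subseteq> {1..m + n}" "card D = m"
    "case x of Truck i \<Rightarrow> v \<notin> D | Drone j \<Rightarrow> v \<in> D"
    using wasting_damage_set[OF assms(1,2) v] by blast
  define X where "X = execution ALG ?K D"
  have X: "executes ALG ?K D X" "feasible ?K D (\<lambda>x. fst (X x))"
    unfolding X_def using execution_executes assms rdp_instance_star D(1) by blast+
  \<comment> \<open>The damage set was tailored to the reference run, but \<open>x\<close> makes the
    same first move in the actual run, so its visit to \<open>v\<close> is wasted there too.\<close>
  have "x \<in> movers ?K X \<and> fst (X x) ! Suc 0 = v"
    unfolding v_def by (rule first_mover_star_independent[OF assms(3) X0(1) X(1) x x_min])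
  then have "v \<in> set (fst (X x))"
    by (auto simp: movers_def)
  then obtain y where "y \<in> vehicles ?K" "length (fst (X y)) \<ge> 5"
    using feasible_star_long_tour[OF X(2) xv v _ D] by blast
  then have "min 4 (4 / a) \<le> alg_makespan ALG ?K D"
    unfolding alg_makespan_def X_def[symmetric]
    by (rule completion_time_star_lower[OF assms(3) X(1)])
  then show ?thesis using that D by blast
qed

section \<open>The competitive ratio\<close>

theorem lemma26:
  fixes kt kd :: nat and \<alpha> :: real and ALG :: policy
  assumes "kt \<ge> 1" and "kd \<ge> 1" and "\<alpha> > 0"
    and "online_policy ALG"
  shows "\<exists>K D. rdp_instance K D \<and> trucks K = kt \<and> drones K = kd \<and> drone_speed K = \<alpha> \<and>
           alg_makespan ALG K D / OPT K D \<ge> min (2 / \<alpha>) (2 * \<alpha>)"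
proof -
  let ?K = "star kt kd \<alpha>"
  obtain D where D: "D \<subseteq> {1..kt + kd}" "card D = kt"
    and alg: "min 4 (4 / \<alpha>) \<le> alg_makespan ALG ?K D"
    using alg_makespan_star_lower[OF assms] by blast
  note opt = OPT_star[OF assms(1-3) D]
  have "min (2 / \<alpha>) (2 * \<alpha>) * OPT ?K D \<le> min (2 / \<alpha>) (2 * \<alpha>) * max 2 (2 / \<alpha>)"
    using opt assms(3) by (intro mult_left_mono) auto
  \<comment> \<open>The slower kind of vehicle determines the bound on the optimum, the faster kind
    the bound on the policy. For \<open>\<alpha> \<le> 1\<close> these are
    \<open>2 / \<alpha>\<close> and \<open>4\<close>, with quotient \<open>2 * \<alpha>\<close>;
    otherwise they are \<open>2\<close> and \<open>4 / \<alpha>\<close>, with quotient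
    \<open>2 / \<alpha>\<close>.\<close>
  also have "\<dots> \<le> min 4 (4 / \<alpha>)"
  proof (cases "\<alpha> \<le> 1")
    case True
    then have "max 2 (2 / \<alpha>) = 2 / \<alpha>" "min 4 (4 / \<alpha>) = 4"
      using assms(3) by (auto simp: field_simps)
    moreover have "min (2 / \<alpha>) (2 * \<alpha>) * (2 / \<alpha>) \<le> 2 * \<alpha> * (2 / \<alpha>)"
      using assms(3) by (intro mult_right_mono) auto
    ultimately show ?thesis using assms(3) by simp
  next
    case False
    then have "max 2 (2 / \<alpha>) = 2" "min 4 (4 / \<alpha>) = 4 / \<alpha>"
      using assms(3) by (auto simp: field_simps)
    then show ?thesis by simp
  qed
  also note alg
  finally have "min (2 / \<alpha>) (2 * \<alpha>) \<le> alg_makespan ALG ?K D / OPT ?K D"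
    using opt(1) by (simp add: pos_le_divide_eq)
  then show ?thesis
    using rdp_instance_star[OF assms(1-3) D(1)] by (intro exI[of _ ?K] exI[of _ D]) simp
qed

end
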